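(* Let $f : S^1 \to S^1$ be a minimal homeomorphism of the circle (every orbit is dense). Then $f$ possesses a natural measure in the strong sense which is physical.
   Context: Let $m$ be normalized Lebesgue measure on $S^1$; Borel probability measures on $S^1$ carry the weak* topology, and $f_*$ denotes push-forward of measures. A Borel probability measure $\mu$ on $S^1$ is a natural measure in the strong sense for $f$ if for every Borel probability measure $\nu \ll m$ one has $\frac{1}{n}\sum_{i=0}^{n-1} f_*^i\nu \to \mu$ in the weak* topology as $n \to \infty$. The basin of $\mu$ is $B(\mu) = \{x \in S^1 : \frac{1}{n}\sum_{i=0}^{n-1}\delta_{f^i(x)} \to \mu \text{ weak*}\}$, where $\delta_y$ is the Dirac measure at $y$, and an invariant probability measure $\mu$ is physical if $m(B(\mu)) > 0$. *)

theory Defs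
  imports "HOL-Probability.Probability"
begin

text \<open>The circle is the unit circle of the complex plane. Self-maps of it are functions on all of
  \<^typ>\<open>complex\<close>, whose values off the circle are irrelevant.\<close>

abbreviation circle :: "complex set" where
  "circle \<equiv> sphere 0 1"

abbreviation circle_borel :: "complex measure" where
  "circle_borel \<equiv> restrict_space borel circle"

definition circle_lebesgue :: "complex measure" where
  "circle_lebesgue =
     distr (uniform_measure lborel {0..<1}) circle_borel (\<lambda>t::real. cis (2 * pi * t))"

definition borel_prob :: "complex measure \<Rightarrow> bool" where
  "borel_prob \<mu> \<longleftrightarrow> prob_space \<mu> \<and> sets \<mu> = sets circle_borel"

definition weak_star_tendsto :: "(nat \<Rightarrow> complex measure) \<Rightarrow> complex measure \<Rightarrow> bool" where
  "weak_star_tendsto \<mu>s \<mu> \<longleftrightarrow>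
     (\<forall>\<phi>::complex \<Rightarrow> real. continuous_on circle \<phi> \<longrightarrow>
        (\<lambda>n. integral\<^sup>L (\<mu>s n) \<phi>) \<longlonglongrightarrow> integral\<^sup>L \<mu> \<phi>)"

text \<open>The measure \<open>(1/n) (\<mu>s 0 + ... + \<mu>s (n - 1))\<close>; for \<open>n = 0\<close> it is the null measure.\<close>

definition average_measure :: "(nat \<Rightarrow> complex measure) \<Rightarrow> nat \<Rightarrow> complex measure" where
  "average_measure \<mu>s n =
     measure_of circle (sets circle_borel)
       (\<lambda>A. ennreal (1 / real n) * (\<Sum>i<n. emeasure (\<mu>s i) A))"

definition natural_measure_strong :: "(complex \<Rightarrow> complex) \<Rightarrow> complex measure \<Rightarrow> bool" where
  "natural_measure_strong f \<mu> \<longleftrightarrow> borel_prob \<mu> \<and>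
     (\<forall>\<nu>. borel_prob \<nu> \<and> absolutely_continuous circle_lebesgue \<nu> \<longrightarrow>
        weak_star_tendsto (average_measure (\<lambda>i. distr \<nu> circle_borel (f ^^ i))) \<mu>)"

definition basin :: "(complex \<Rightarrow> complex) \<Rightarrow> complex measure \<Rightarrow> complex set" where
  "basin f \<mu> =
     {x \<in> circle. weak_star_tendsto (average_measure (\<lambda>i. return circle_borel ((f ^^ i) x))) \<mu>}"

definition physical_measure :: "(complex \<Rightarrow> complex) \<Rightarrow> complex measure \<Rightarrow> bool" where
  "physical_measure f \<mu> \<longleftrightarrow> borel_prob \<mu> \<and> distr \<mu> circle_borel f = \<mu> \<and>
     emeasure circle_lebesgue (basin f \<mu>) > 0"

definition circle_homeo :: "(complex \<Rightarrow> complex) \<Rightarrow> bool" where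
  "circle_homeo f \<longleftrightarrow> (\<exists>g. homeomorphism circle circle f g)"

definition full_orbit :: "(complex \<Rightarrow> complex) \<Rightarrow> complex \<Rightarrow> complex set" where
  "full_orbit f x = range (\<lambda>n. (f ^^ n) x) \<union> range (\<lambda>n. (inv_into circle f ^^ n) x)"

definition minimal_circle_homeo :: "(complex \<Rightarrow> complex) \<Rightarrow> bool" where
  "minimal_circle_homeo f \<longleftrightarrow> circle_homeo f \<and> (\<forall>x\<in>circle. circle \<subseteq> closure (full_orbit f x))"

lemma borel_prob_circle_lebesgue: "borel_prob circle_lebesgue"
proof -
  have "(\<lambda>t::real. cis (2 * pi * t)) \<in> borel_measurable borel"
    by (intro borel_measurable_continuous_onI continuous_intros)
  then have "(\<lambda>t::real. cis (2 * pi * t)) \<in> uniform_measure lborel {0..<1} \<rightarrow>\<^sub>M circle_borel"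
    by (intro measurable_restrict_space2) auto
  moreover have "prob_space (uniform_measure lborel {0..<1::real})"
    by (rule prob_space_uniform_measure) auto
  ultimately show ?thesis
    by (auto simp: borel_prob_def circle_lebesgue_def intro: prob_space.prob_space_distr)
qed

text \<open>\<^const>\<open>measure_of\<close> yields the null measure unless it is given a measure; here it is.\<close>

lemma emeasure_average_measure:
  assumes "\<And>i. sets (\<mu>s i) = sets circle_borel" and "A \<in> sets circle_borel"
  shows "emeasure (average_measure \<mu>s n) A = ennreal (1 / real n) * (\<Sum>i<n. emeasure (\<mu>s i) A)"
proof (rule emeasure_measure_of[OF average_measure_def])
  show "sets circle_borel \<subseteq> Pow circle"
    using sets.space_closed[of circle_borel] by (simp add: space_restrict_space)
  show "A \<in> sets (average_measure \<mu>s n)"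
    using assms(2) sets.sets_measure_of_eq[of circle_borel]
    by (simp add: average_measure_def space_restrict_space)
  show "positive (sets (average_measure \<mu>s n))
      (\<lambda>A. ennreal (1 / real n) * (\<Sum>i<n. emeasure (\<mu>s i) A))"
    by (simp add: positive_def)
  have sets: "sets (average_measure \<mu>s n) = sets circle_borel"
    using sets.sets_measure_of_eq[of circle_borel]
    by (simp add: average_measure_def space_restrict_space)
  show "countably_additive (sets (average_measure \<mu>s n))
      (\<lambda>A. ennreal (1 / real n) * (\<Sum>i<n. emeasure (\<mu>s i) A))"
  proof (rule countably_additiveI)
    fix B :: "nat \<Rightarrow> complex set"
    assume B: "range B \<subseteq> sets (average_measure \<mu>s n)" "disjoint_family B"
    have "(\<Sum>j. \<Sum>i<n. emeasure (\<mu>s i) (B j)) = (\<Sum>i<n. \<Sum>j. emeasure (\<mu>s i) (B j))"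
      by (rule suminf_sum) auto
    also have "\<dots> = (\<Sum>i<n. emeasure (\<mu>s i) (\<Union>j. B j))"
      using B assms(1) sets by (intro sum.cong refl suminf_emeasure) auto
    finally show "(\<Sum>j. ennreal (1 / real n) * (\<Sum>i<n. emeasure (\<mu>s i) (B j))) =
        ennreal (1 / real n) * (\<Sum>i<n. emeasure (\<mu>s i) (\<Union>j. B j))"
      by simp
  qed
qed

end

theory Submission
  imports Defs "HOL-Library.Real_Mod" "HOL-Analysis.Kronecker_Approximation_Theorem"
begin

text \<open>By minimality, \<open>f\<close> lifts to an increasing \<open>F\<close> with \<open>F (t + 1) = F t + 1\<close>. Its translation
  number \<open>\<rho>\<close> satisfies \<open>\<bar>F\<^sup>n t - t - n\<rho>\<bar> \<le> 2\<close> and is irrational, since otherwise \<open>f\<close> would have a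
  periodic point. The supremum of \<open>F\<^sup>n t - n\<rho>\<close> over all integers \<open>n\<close> is a monotone function of \<open>t\<close>
  conjugating \<open>F\<close> to the translation by \<open>\<rho>\<close>; it is continuous because its range is dense, and
  strictly increasing because its points of growth form a closed invariant set. Thus \<open>f\<close> is
  conjugate to an irrational rotation. The measure \<open>\<mu>\<close> is the image of the uniform measure under the
  inverse conjugacy: by equidistribution the Birkhoff averages of a continuous function converge at
  every point to its \<open>\<mu>\<close>-integral, so the basin of \<open>\<mu>\<close> is the whole circle, and dominated
  convergence handles every initial measure \<open>\<nu>\<close>.\<close>

section \<open>Lifts of circle maps\<close>

definition circ :: "real \<Rightarrow> complex" where
  "circ t = cis (2 * pi * t)"

lemma continuous_on_circ: "continuous_on A circ"
  unfolding circ_def by (intro continuous_intros)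

lemma norm_circ [simp]: "cmod (circ t) = 1"
  by (simp add: circ_def)

lemma circ_in_circle: "circ t \<in> circle"
  by simp

lemma circ_eq_iff: "circ s = circ t \<longleftrightarrow> s - t \<in> \<int>"
proof
  assume "circ s = circ t"
  then have "cis (2 * pi * s - 2 * pi * t) = 1"
    by (simp add: circ_def cis_divide[symmetric])
  then obtain n :: int where "2 * pi * s - 2 * pi * t = of_int n * (2 * pi)"
    using cis_eq_1_iff by blast
  then have "2 * pi * (s - t) = 2 * pi * of_int n"
    by (simp add: algebra_simps)
  then have "s - t = of_int n"
    by simp
  then show "s - t \<in> \<int>"
    by simp
next
  assume "s - t \<in> \<int>"
  then obtain n :: int where "s = t + of_int n"
    by (metis Ints_cases add.commute diff_add_cancel)
  then have "circ s = circ t * cis (of_int n * (2 * pi))"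
    by (simp add: circ_def cis_mult algebra_simps)
  also have "cis (of_int n * (2 * pi)) = 1"
    using cis_eq_1_iff by blast
  finally show "circ s = circ t"
    by simp
qed

lemma circ_add_Ints: "k \<in> \<int> \<Longrightarrow> circ (t + k) = circ t"
  by (simp add: circ_eq_iff)

lemma circleE:
  assumes "z \<in> circle"
  obtains t where "0 \<le> t" "t \<le> 1" "z = circ t"
proof -
  have "cmod z = 1"
    using assms by simp
  then have "z = cis (Arg2pi z)"
    by (metis Arg2pi_eq cis_conv_exp mult.commute mult_1 of_real_1)
  then have "z = circ (Arg2pi z / (2 * pi))"
    by (simp add: circ_def)
  moreover have "0 \<le> Arg2pi z / (2 * pi)" "Arg2pi z / (2 * pi) \<le> 1"
    using Arg2pi_ge_0[of z] Arg2pi_lt_2pi[of z] by (simp_all add: field_simps)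
  ultimately show ?thesis
    using that by blast
qed

lemma infinite_circle: "infinite circle"
proof
  assume "finite circle"
  moreover have "circ ` {0..<1} \<subseteq> circle"
    by auto
  moreover have "inj_on circ {0..<1}"
  proof (rule inj_onI)
    fix s t :: real
    assume st: "s \<in> {0..<1}" "t \<in> {0..<1}" "circ s = circ t"
    then obtain n :: int where n: "s - t = of_int n"
      by (auto simp: circ_eq_iff elim: Ints_cases)
    then have "\<bar>of_int n :: real\<bar> < 1"
      using st by auto
    then have "n = 0"
      by linarith
    then show "s = t"
      using n by simp
  qed
  ultimately have "finite {0..<1::real}"
    using finite_imageD finite_subset by blast
  then show False
    using infinite_Ico[of 0 "1::real"] by simp
qed

text \<open>Since \<open>f\<close> is injective, a set mapped onto itself is also preserved by the
  inverse, so it contains the full orbit of each of its points and, being closed, the closure of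
  that orbit.\<close>

lemma minimal_circle_homeo_fixed_set:
  assumes "minimal_circle_homeo f" "closed C" "C \<subseteq> circle" "C \<noteq> {}" "f ` C = C"
  shows "C = circle"
proof -
  obtain g where g: "homeomorphism circle circle f g"
    using assms(1) by (auto simp: minimal_circle_homeo_def circle_homeo_def)
  have "inj_on f circle"
    using g by (metis homeomorphism_def inj_on_inverseI)
  then have inv: "inv_into circle f ` C \<subseteq> C"
    using assms(3,5) by (metis inv_into_image_cancel subset_refl)
  obtain x where "x \<in> C"
    using assms(4) by auto
  have "(f ^^ n) x \<in> C" for n
    using assms(5) \<open>x \<in> C\<close> by (induction n) auto
  moreover have "(inv_into circle f ^^ n) x \<in> C" for n
    using inv \<open>x \<in> C\<close> by (induction n) auto
  ultimately have "full_orbit f x \<subseteq> C"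
    by (auto simp: full_orbit_def)
  then have "closure (full_orbit f x) \<subseteq> C"
    using assms(2) by (rule closure_minimal)
  moreover have "circle \<subseteq> closure (full_orbit f x)"
    using assms(1,3) \<open>x \<in> C\<close> by (auto simp: minimal_circle_homeo_def)
  ultimately show ?thesis
    using assms(3) by auto
qed

text \<open>A periodic orbit is finite, hence closed, and is mapped onto itself, so it would have to
  be the whole infinite circle.\<close>

lemma minimal_circle_homeo_not_periodic:
  assumes "minimal_circle_homeo f" "z \<in> circle" "q > 0"
  shows "(f ^^ q) z \<noteq> z"
proof
  assume per: "(f ^^ q) z = z"
  let ?S = "(\<lambda>i. (f ^^ i) z) ` {..<q}"
  obtain g where "homeomorphism circle circle f g"
    using assms(1) by (auto simp: minimal_circle_homeo_def circle_homeo_def)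
  then have "f ` circle = circle"
    by (simp add: homeomorphism_def)
  then have "(f ^^ i) z \<in> circle" for i
    using assms(2) by (induction i) auto
  moreover have "f ` ?S = ?S"
  proof -
    \<comment> \<open>Applying \<open>f\<close> raises the indices to 1, ..., \<open>q\<close>, and
      periodicity turns the last one back into 0.\<close>
    have "f ` ?S = (\<lambda>i. (f ^^ i) z) ` Suc ` {..<q}"
      by (auto simp: image_image)
    also have "Suc ` {..<q} = insert q {1..<q}"
      using assms(3) by (auto simp: image_iff lessThan_atLeast0 Bex_def intro: Suc_pred[symmetric])
    also have "(\<lambda>i. (f ^^ i) z) ` insert q {1..<q} = (\<lambda>i. (f ^^ i) z) ` insert 0 {1..<q}"
      using per by simp
    also have "insert 0 {1..<q} = {..<q}"
      using assms(3) by auto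
    finally show ?thesis .
  qed
  moreover have "?S \<noteq> {}"
    using assms(3) by auto
  ultimately have "?S = circle"
    by (intro minimal_circle_homeo_fixed_set[OF assms(1)] finite_imp_closed) auto
  then show False
    using infinite_circle by (metis finite_imageI finite_lessThan)
qed

text \<open>The line is simply connected and \<open>f (circ t)\<close> never vanishes, so it has a
  continuous logarithm. Modulus 1 makes the logarithm purely imaginary, and dividing its imaginary
  part by \<open>2 * pi\<close> gives the lift.\<close>

lemma continuous_circle_map_lift:
  assumes "continuous_on circle f" "f ` circle \<subseteq> circle"
  obtains F where "continuous_on UNIV F" "\<And>t. circ (F t) = f (circ t)"
proof -
  have "continuous_on UNIV (\<lambda>t. f (circ t))"
    by (rule continuous_on_compose2[OF assms(1) continuous_on_circ]) auto
  moreover have "simply_connected (UNIV :: real set)" "locally path_connected (UNIV :: real set)"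
    by (auto intro: convex_imp_simply_connected convex_imp_locally_path_connected)
  moreover have norm: "cmod (f (circ t)) = 1" for t
    using assms(2) circ_in_circle by (metis image_subset_iff mem_sphere_0)
  then have "f (circ t) \<noteq> 0" for t
    by (metis norm_zero zero_neq_one)
  ultimately obtain L where L: "continuous_on UNIV L" "\<And>t. f (circ t) = exp (L t)"
    using continuous_logarithm_on_simply_connected[of UNIV "\<lambda>t. f (circ t)"] by auto
  have "exp (Re (L t)) = 1" for t
    using norm[of t] by (simp add: L(2))
  then have "L t = \<i> * of_real (Im (L t))" for t
    by (simp add: complex_eq_iff)
  then have "f (circ t) = cis (Im (L t))" for t
    by (metis L(2) cis_conv_exp)
  then show ?thesis
    using L(1) by (intro that[of "\<lambda>t. Im (L t) / (2 * pi)"])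
      (auto intro!: continuous_intros simp: circ_def)
qed

text \<open>Distinct integers are at distance at least 1, so connectedness of the line leaves room
  for one value only.\<close>

lemma continuous_Ints_valued_constant:
  fixes h :: "real \<Rightarrow> real"
  assumes "continuous_on UNIV h" "\<And>t. h t \<in> \<int>"
  obtains d :: int where "\<And>t. h t = of_int d"
proof -
  have "h constant_on UNIV"
  proof (rule continuous_discrete_range_constant[OF connected_UNIV assms(1)])
    fix x :: real
    have "1 \<le> norm (h y - h x)" if "h y \<noteq> h x" for y
      using that assms(2)[of x] assms(2)[of y] by (metis Ints_nonzero_abs_ge1 Ints_diff
          eq_iff_diff_eq_0 real_norm_def)
    then show "\<exists>e>0. \<forall>y. y \<in> UNIV \<and> h y \<noteq> h x \<longrightarrow> e \<le> norm (h y - h x)"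
      by (intro exI[of _ 1]) auto
  qed
  then obtain c where "\<And>t. h t = c"
    by (auto simp: constant_on_def)
  then show ?thesis
    using assms(2) that by (metis Ints_cases)
qed

text \<open>The type of values is arbitrary, so this also covers periodic predicates; maps that
  commute with unit translations are handled by first subtracting a linear function.\<close>

lemma periodic_add_int:
  assumes "\<And>t::real. k (t + 1) = k t"
  shows "k (t + of_int m) = k t"
proof (induction m rule: int_induct[where k = 0])
  case (step1 i)
  then show ?case
    using assms[of "t + of_int i"] by (simp add: algebra_simps)
next
  case (step2 i)
  then show ?case
    using assms[of "t + of_int (i - 1)"] by (simp add: algebra_simps)
qed simp

lemma circle_map_lift_degree:
  assumes "continuous_on UNIV F" "\<And>t. circ (F t) = f (circ t)"
  obtains d :: int where "\<And>t (k::int). F (t + of_int k) = F t + of_int (k * d)"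
proof -
  have "F (t + 1) - F t \<in> \<int>" for t
    using assms(2) circ_eq_iff circ_add_Ints by (metis Ints_1)
  moreover have "continuous_on UNIV (\<lambda>t. F (t + 1) - F t)"
    by (intro continuous_intros continuous_on_compose2[OF assms(1)]) auto
  ultimately obtain d :: int where d: "\<And>t. F (t + 1) - F t = of_int d"
    using continuous_Ints_valued_constant[of "\<lambda>t. F (t + 1) - F t"] by auto
  have "F (t + of_int k) = F t + of_int (k * d)" for t and k :: int
    using periodic_add_int[of "\<lambda>t. F t - of_int d * t" t k] d by (simp add: algebra_simps)
  then show ?thesis
    using that by blast
qed

text \<open>A lift of degree \<open>-1\<close> has a fixed point, so minimality forces degree \<open>1\<close>.\<close>

lemma minimal_circle_homeo_lift:
  assumes "minimal_circle_homeo f"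
  obtains F where "strict_mono F" "continuous_on UNIV F" "\<And>t. F (t + 1) = F t + 1"
    "\<And>t. circ (F t) = f (circ t)"
proof -
  obtain g where "homeomorphism circle circle f g"
    using assms(1) by (auto simp: minimal_circle_homeo_def circle_homeo_def)
  then have fg: "continuous_on circle f" "continuous_on circle g" "f ` circle \<subseteq> circle"
      "g ` circle \<subseteq> circle" "\<And>z. z \<in> circle \<Longrightarrow> g (f z) = z"
    by (auto simp: homeomorphism_def)
  obtain F where F: "continuous_on UNIV F" "\<And>t. circ (F t) = f (circ t)"
    using continuous_circle_map_lift[OF fg(1,3)] by blast
  obtain G where G: "continuous_on UNIV G" "\<And>t. circ (G t) = g (circ t)"
    using continuous_circle_map_lift[OF fg(2,4)] by blast
  obtain d where d: "\<And>t (k::int). F (t + of_int k) = F t + of_int (k * d)"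
    using circle_map_lift_degree[OF F] by blast
  obtain d' where d': "\<And>t (k::int). G (t + of_int k) = G t + of_int (k * d')"
    using circle_map_lift_degree[OF G] by blast
  \<comment> \<open>\<open>G\<close> after \<open>F\<close> lifts the identity, so it is a
    translation by an integer \<open>c\<close>. This yields injectivity of \<open>F\<close> and
    shows that the two degrees have product 1.\<close>
  have "circ (G (F t)) = circ t" for t
    using F(2) G(2) fg(5) by simp
  then have "G (F t) - t \<in> \<int>" for t
    by (simp add: circ_eq_iff)
  moreover have "continuous_on UNIV (\<lambda>t. G (F t) - t)"
    by (intro continuous_intros continuous_on_compose2[OF G(1) F(1)]) auto
  ultimately obtain c :: int where c: "\<And>t. G (F t) - t = of_int c"
    using continuous_Ints_valued_constant[of "\<lambda>t. G (F t) - t"] by auto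
  have "inj F"
  proof (rule injI)
    fix s t assume "F s = F t"
    then show "s = t"
      using c[of s] c[of t] by simp
  qed
  have "real_of_int (d * d') = 1"
    using c[of 0] c[of 1] d[of 0 1] d'[of "F 0" d] by simp
  then have "d * d' = 1"
    by linarith
  then have "d = 1 \<or> d = -1"
    by (auto simp: zmult_eq_1_iff)
  then show ?thesis
  proof
    assume [simp]: "d = 1"
    have F1: "F (t + 1) = F t + 1" for t
      using d[of t 1] by simp
    \<comment> \<open>A continuous injective function on the line is strictly monotone; degree 1
      rules out the decreasing case.\<close>
    have "strict_mono F \<or> strict_antimono_on UNIV F"
      using injective_eq_monotone_map[of UNIV F] F(1) \<open>inj F\<close> by (simp add: is_interval_univ)
    moreover have "\<not> strict_antimono_on UNIV F"
    proof
      assume "strict_antimono_on UNIV F"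
      then have "F (0 + 1) < F 0"
        by (simp add: monotone_on_def)
      then show False
        using F1[of 0] by linarith
    qed
    ultimately show ?thesis
      using that[of F] F F1 by blast
  next
    assume [simp]: "d = -1"
    \<comment> \<open>In degree -1 the function \<open>F t - t\<close> drops by 2 under each unit
      translation, so it changes sign between \<open>- k\<close> and \<open>k\<close>.\<close>
    obtain k :: int where k: "\<bar>F 0\<bar> \<le> of_int k"
      using ex_le_of_int by blast
    have "F (0 + of_int k) = F 0 - of_int k" "F (0 + of_int (- k)) = F 0 + of_int k"
      using d[of 0 k] d[of 0 "- k"] by simp_all
    then have "F (of_int k) - of_int k \<le> 0" "0 \<le> F (- of_int k) - (- of_int k)"
        "- of_int k \<le> (of_int k :: real)"
      using k by simp_all
    moreover have "continuous_on {- of_int k..of_int k} (\<lambda>t. F t - t)"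
      by (intro continuous_intros continuous_on_subset[OF F(1)]) auto
    ultimately obtain t where "F t - t = 0"
      using IVT2'[of "\<lambda>t. F t - t" "of_int k" 0 "- of_int k"] by auto
    then have "(f ^^ 1) (circ t) = circ t"
      using F(2)[of t] by simp
    then show ?thesis
      using minimal_circle_homeo_not_periodic[OF assms, of "circ t" 1] by simp
  qed
qed

section \<open>Conjugacy to a rotation\<close>

text \<open>Kronecker's theorem in dimension one, with a natural number \<open>k\<close> so that
  forward iterates realise the approximation.\<close>

lemma irrational_orbit_dense:
  fixes \<rho> :: real
  assumes "\<rho> \<notin> \<rat>" "\<delta> > 0"
  obtains k :: nat and m :: int where "\<bar>s + real k * \<rho> + of_int m - t\<bar> < \<delta>"
proof -
  obtain h k where "k > 0" "\<bar>of_int k * \<rho> - of_int h - (t - s)\<bar> < \<delta>"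
    using sequence_of_fractional_parts_is_dense[OF assms] .
  then show ?thesis
    by (intro that[of "nat k" "- h"]) (simp add: algebra_simps)
qed

text \<open>A monotone function is discontinuous only where it jumps over an interval. Here values
  just below and just above \<open>h x\<close> are attained at points \<open>a\<close> and
  \<open>b\<close>, and \<open>h\<close> stays between these values on the interval from
  \<open>a\<close> to \<open>b\<close>.\<close>

lemma mono_dense_range_continuous:
  fixes h :: "real \<Rightarrow> real"
  assumes "mono h" "\<And>u v. u < v \<Longrightarrow> \<exists>t. u < h t \<and> h t < v"
  shows "continuous_on UNIV h"
proof -
  have "isCont h x" for x
    unfolding continuous_at_real_range
  proof (intro allI impI)
    fix e :: real assume "e > 0"
    obtain a where a: "h x - e < h a" "h a < h x"
      using assms(2)[of "h x - e" "h x"] \<open>e > 0\<close> by auto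
    obtain b where b: "h x < h b" "h b < h x + e"
      using assms(2)[of "h x" "h x + e"] \<open>e > 0\<close> by auto
    note ab = a b
    have "a < x" "x < b"
      using ab monoD[OF assms(1), of x a] monoD[OF assms(1), of b x] by (meson leD not_le_imp_less)+
    moreover have "\<bar>h y - h x\<bar> < e" if "a < y" "y < b" for y
      using that ab monoD[OF assms(1), of a y] monoD[OF assms(1), of y b] by linarith
    ultimately show "\<exists>d>0. \<forall>y. norm (y - x) < d \<longrightarrow> \<bar>h y - h x\<bar> < e"
      by (intro exI[of _ "min (x - a) (b - x)"]) auto
  qed
  then show ?thesis
    by (simp add: continuous_at_imp_continuous_on)
qed

section \<open>Increasing lifts of degree one and their translation number\<close>

locale degree_one_lift =
  fixes F :: "real \<Rightarrow> real"
  assumes strict_mono_F: "strict_mono F"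
    and continuous_F: "continuous_on UNIV F"
    and F_add_1: "F (t + 1) = F t + 1"
begin

lemma F_less_iff [simp]: "F s < F t \<longleftrightarrow> s < t"
  using strict_mono_F by (simp add: strict_mono_less)

lemma F_add_int: "F (t + of_int k) = F t + of_int k"
  using periodic_add_int[of "\<lambda>t. F t - t" t k] F_add_1 by simp

lemma bij_F: "bij F"
proof (rule bijI)
  show "inj F"
    using strict_mono_F by (rule strict_mono_imp_inj_on)
  show "surj F"
    unfolding surj_def
  proof
    fix y
    obtain k :: int where k: "\<bar>F 0\<bar> + \<bar>y\<bar> \<le> of_int k"
      using ex_le_of_int by blast
    have "F (of_int k) = F 0 + of_int k" "F (- of_int k) = F 0 - of_int k"
      using F_add_int[of 0 k] F_add_int[of 0 "- k"] by simp_all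
    then have "F (- of_int k) \<le> y" "y \<le> F (of_int k)" "- of_int k \<le> (of_int k :: real)"
      using k by linarith+
    then show "\<exists>x. y = F x"
      using IVT'[of F "- of_int k" y "of_int k"] continuous_on_subset[OF continuous_F] by blast
  qed
qed

lemma F_inv [simp]: "F (inv F t) = t" and inv_F [simp]: "inv F (F t) = t"
  using bij_F by (simp_all add: bij_is_surj bij_is_inj surj_f_inv_f)

lemma strict_mono_funpow_F: "strict_mono (F ^^ n)"
  by (induction n) (auto simp: strict_mono_def)

lemma funpow_F_add_int: "(F ^^ n) (t + of_int k) = (F ^^ n) t + of_int k"
  by (induction n) (simp_all add: F_add_int)

lemma continuous_funpow_F: "continuous_on UNIV (F ^^ n)"
proof (induction n)
  case (Suc n)
  then show ?case
    unfolding funpow.simps by (rule continuous_on_compose) (rule continuous_on_subset[OF continuous_F], simp)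
qed simp

text \<open>The displacement of \<open>F ^^ n\<close> has period 1, and on the unit interval
  monotonicity confines \<open>F ^^ n\<close> between its values at 0 and 1, which differ by
  1.\<close>

lemma funpow_F_displacement: "\<bar>(F ^^ n) t - t - (F ^^ n) 0\<bar> \<le> 1"
proof -
  have "(F ^^ n) t = (F ^^ n) (frac t) + of_int \<lfloor>t\<rfloor>"
    using funpow_F_add_int[of n "frac t" "\<lfloor>t\<rfloor>"] by (simp add: frac_def)
  moreover have "(F ^^ n) 0 \<le> (F ^^ n) (frac t)" "(F ^^ n) (frac t) \<le> (F ^^ n) 1"
    using strict_mono_less_eq[OF strict_mono_funpow_F[of n]] frac_ge_0[of t] frac_lt_1[of t]
    by (simp_all add: less_imp_le)
  moreover have "(F ^^ n) 1 = (F ^^ n) 0 + 1"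
    using funpow_F_add_int[of n 0 1] by simp
  ultimately show ?thesis
    using frac_ge_0[of t] frac_lt_1[of t] unfolding frac_def by linarith
qed

text \<open>Each further block of \<open>n\<close> iterates moves the point by
  \<open>(F ^^ n) 0\<close> up to an error of 1.\<close>

lemma funpow_F_mult: "\<bar>(F ^^ (k * n)) 0 - real k * (F ^^ n) 0\<bar> \<le> real k"
proof (induction k)
  case (Suc k)
  have "(F ^^ (Suc k * n)) 0 = (F ^^ n) ((F ^^ (k * n)) 0)"
    by (simp add: funpow_add)
  then show ?case
    using Suc funpow_F_displacement[of n "(F ^^ (k * n)) 0"] by (simp add: algebra_simps abs_le_iff)
qed simp

text \<open>This is the translation number, the limit of \<open>(F ^^ n) 0 / n\<close>. Taking the
  supremum of its lower bounds gives the error estimate for every \<open>n\<close> directly, without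
  first proving convergence.\<close>

definition rot :: real where
  "rot = (SUP n\<in>{0<..}. ((F ^^ n) 0 - 1) / real n)"

lemma rot_0: "\<bar>(F ^^ n) 0 - real n * rot\<bar> \<le> 1"
proof (cases "n = 0")
  case False
  \<comment> \<open>Splitting \<open>n * m\<close> iterates into blocks of length \<open>m\<close>
    or of length \<open>n\<close> shows that every lower bound lies below every upper bound.\<close>
  have le: "((F ^^ m) 0 - 1) / real m \<le> ((F ^^ n) 0 + 1) / real n" if "m > 0" "n > 0" for m n
  proof -
    have "real n * ((F ^^ m) 0 - 1) \<le> (F ^^ (n * m)) 0"
      using funpow_F_mult[of n m] by (simp add: algebra_simps abs_le_iff)
    also have "\<dots> \<le> real m * ((F ^^ n) 0 + 1)"
      using funpow_F_mult[of m n] by (simp add: algebra_simps abs_le_iff)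
    finally show ?thesis
      using that by (simp add: field_simps)
  qed
  have "rot \<le> ((F ^^ n) 0 + 1) / real n"
    unfolding rot_def using le False by (intro cSUP_least) auto
  moreover have "((F ^^ n) 0 - 1) / real n \<le> rot"
    unfolding rot_def using le[of _ 1] False by (intro cSUP_upper bdd_aboveI2) auto
  ultimately show ?thesis
    using False by (simp add: field_simps abs_le_iff)
qed simp

lemma rot: "\<bar>(F ^^ n) t - t - real n * rot\<bar> \<le> 2"
  using rot_0[of n] funpow_F_displacement[of n t] by linarith

text \<open>If \<open>rot\<close> is \<open>p / q\<close>, then \<open>F ^^ q\<close> followed by
  translation by \<open>- p\<close> is a monotone map with bounded iterates. The orbit of 0 under it
  is a bounded monotone sequence, and its limit is a fixed point.\<close>

lemma rational_rot_periodic: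
  assumes "rot \<in> \<rat>"
  obtains q p t where "q > 0" "(F ^^ q) t = t + of_int p"
proof -
  obtain p :: int and q :: int where pq: "q > 0" "rot = of_int p / of_int q"
    using assms by (metis Rats_cases')
  define G where "G t = (F ^^ nat q) t - of_int p" for t
  have G_funpow: "(G ^^ k) t = (F ^^ (k * nat q)) t - of_int (int k * p)" for k t
  proof (induction k)
    case (Suc k)
    then show ?case
      using funpow_F_add_int[of "nat q" "(F ^^ (k * nat q)) t" "- (int k * p)"]
      by (simp add: Suc G_def[of "_ - _"] funpow_add algebra_simps)
  qed simp
  have "mono G"
    using strict_mono_mono[OF strict_mono_funpow_F[of "nat q"]] by (simp add: G_def mono_def)
  have "monoseq (\<lambda>k. (G ^^ k) 0)"
  proof (cases "0 \<le> G 0")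
    case True
    have "(G ^^ k) 0 \<le> (G ^^ k) (G 0)" for k
      using True \<open>mono G\<close> by (simp add: funpow_mono)
    then show ?thesis
      by (auto simp: monoseq_Suc funpow_swap1)
  next
    case False
    have "(G ^^ k) (G 0) \<le> (G ^^ k) 0" for k
      using False \<open>mono G\<close> by (simp add: funpow_mono)
    then show ?thesis
      by (auto simp: monoseq_Suc funpow_swap1)
  qed
  moreover have "\<bar>(G ^^ k) 0\<bar> \<le> 2" for k
    using rot[of "k * nat q" 0] pq by (simp add: G_funpow)
  then have "Bseq (\<lambda>k. (G ^^ k) 0)"
    by (intro BseqI'[of _ 2]) simp
  ultimately obtain L where L: "(\<lambda>k. (G ^^ k) 0) \<longlonglongrightarrow> L"
    using Bseq_monoseq_convergent by (auto simp: convergent_def)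
  have "continuous_on UNIV G"
    unfolding G_def by (intro continuous_intros continuous_funpow_F)
  then have "isCont G L"
    by (simp add: continuous_on_eq_continuous_at)
  then have "(\<lambda>k. G ((G ^^ k) 0)) \<longlonglongrightarrow> G L"
    using L by (rule isCont_tendsto_compose)
  moreover have "(\<lambda>k. G ((G ^^ k) 0)) \<longlonglongrightarrow> L"
    using LIMSEQ_Suc[OF L] by simp
  ultimately have "G L = L"
    by (rule LIMSEQ_unique)
  then show ?thesis
    using pq by (intro that[of "nat q" L p]) (auto simp: G_def)
qed

section \<open>The function conjugating the lift to a translation\<close>

text \<open>Backward iterates stand for the negative indices. Using both directions makes the set at
  \<open>F t\<close> an exact translate of the set at \<open>t\<close>, so the supremum satisfies an
  exact functional equation.\<close>

definition conjugacy_set :: "real \<Rightarrow> real set" where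
  "conjugacy_set t = range (\<lambda>n. (F ^^ n) t - real n * rot) \<union> range (\<lambda>n. (inv F ^^ n) t + real n * rot)"

definition conjugacy :: "real \<Rightarrow> real" where
  "conjugacy t = Sup (conjugacy_set t)"

lemma inv_F_add_1: "inv F (t + 1) = inv F t + 1"
  using F_add_1[of "inv F t"] by (metis F_inv inv_F)

lemma inv_F_mono: "s \<le> t \<Longrightarrow> inv F s \<le> inv F t"
  using F_less_iff[of "inv F t" "inv F s"] by (simp add: not_less[symmetric])

lemma F_funpow_inv: "(F ^^ n) ((inv F ^^ n) t) = t"
proof (induction n arbitrary: t)
  case (Suc n)
  then show ?case
    by (simp add: funpow_swap1)
qed simp

lemma funpow_inv_F_displacement: "\<bar>(inv F ^^ n) t - t + real n * rot\<bar> \<le> 2"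
  using rot[of n "(inv F ^^ n) t"] by (simp add: F_funpow_inv)

lemma conjugacy_set_bound: "x \<in> conjugacy_set t \<Longrightarrow> \<bar>x - t\<bar> \<le> 2"
  using rot[of _ t] funpow_inv_F_displacement[of _ t]
  by (auto simp: conjugacy_set_def algebra_simps)

lemma conjugacy_set_bdd: "bdd_above (conjugacy_set t)"
  using conjugacy_set_bound by (intro bdd_aboveI[of _ "t + 2"]) force

lemma conjugacy_set_nonempty: "conjugacy_set t \<noteq> {}"
  by (simp add: conjugacy_set_def)

text \<open>Passing from \<open>t\<close> to \<open>F t\<close> shifts the integer index by one. The
  cases at 0 are where the shift crosses from one half of the set into the other.\<close>

lemma conjugacy_set_F: "conjugacy_set (F t) = (\<lambda>x. rot + x) ` conjugacy_set t"
proof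
  have "(F ^^ n) (F t) - real n * rot \<in> (\<lambda>x. rot + x) ` conjugacy_set t" for n
  proof (rule image_eqI)
    show "(F ^^ Suc n) t - real (Suc n) * rot \<in> conjugacy_set t"
      unfolding conjugacy_set_def by blast
    show "(F ^^ n) (F t) - real n * rot = rot + ((F ^^ Suc n) t - real (Suc n) * rot)"
      by (simp add: funpow_swap1 algebra_simps)
  qed
  moreover have "(inv F ^^ n) (F t) + real n * rot \<in> (\<lambda>x. rot + x) ` conjugacy_set t" for n
  proof (cases n)
    case 0
    have "(F ^^ 1) t - real 1 * rot \<in> conjugacy_set t"
      unfolding conjugacy_set_def by blast
    then show ?thesis
      by (rule rev_image_eqI) (simp add: 0)
  next
    case (Suc k)
    show ?thesis
      by (rule image_eqI[of _ _ "(inv F ^^ k) t + real k * rot"])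
        (auto simp: Suc conjugacy_set_def funpow_swap1 algebra_simps)
  qed
  ultimately show "conjugacy_set (F t) \<subseteq> (\<lambda>x. rot + x) ` conjugacy_set t"
    unfolding conjugacy_set_def[of "F t"] by blast
next
  have "rot + ((F ^^ n) t - real n * rot) \<in> conjugacy_set (F t)" for n
  proof (cases n)
    case 0
    have "(inv F ^^ 1) (F t) + real 1 * rot \<in> conjugacy_set (F t)"
      unfolding conjugacy_set_def by blast
    then show ?thesis
      by (simp add: 0 add.commute)
  next
    case (Suc k)
    have "(F ^^ k) (F t) - real k * rot \<in> conjugacy_set (F t)"
      unfolding conjugacy_set_def by blast
    then show ?thesis
      by (simp add: Suc funpow_swap1 algebra_simps)
  qed
  moreover have "rot + ((inv F ^^ n) t + real n * rot) \<in> conjugacy_set (F t)" for n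
  proof -
    have "(inv F ^^ Suc n) (F t) + real (Suc n) * rot \<in> conjugacy_set (F t)"
      unfolding conjugacy_set_def by blast
    then show ?thesis
      by (simp add: funpow_swap1 algebra_simps)
  qed
  ultimately show "(\<lambda>x. rot + x) ` conjugacy_set t \<subseteq> conjugacy_set (F t)"
    unfolding conjugacy_set_def[of t] by blast
qed

lemma conjugacy_set_add_1: "conjugacy_set (t + 1) = (\<lambda>x. 1 + x) ` conjugacy_set t"
proof -
  have "(F ^^ n) (t + 1) = (F ^^ n) t + 1" for n
    using funpow_F_add_int[of n t 1] by simp
  moreover have "(inv F ^^ n) (t + 1) = (inv F ^^ n) t + 1" for n
    by (induction n) (simp_all add: inv_F_add_1)
  ultimately show ?thesis
    by (auto simp: conjugacy_set_def image_Un image_image algebra_simps)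
qed

lemma conjugacy_F: "conjugacy (F t) = conjugacy t + rot"
  using Sup_add_eq[of "\<lambda>x. x" "conjugacy_set t" rot]
  by (simp add: conjugacy_def conjugacy_set_F conjugacy_set_nonempty conjugacy_set_bdd)

lemma conjugacy_add_1: "conjugacy (t + 1) = conjugacy t + 1"
  using Sup_add_eq[of "\<lambda>x. x" "conjugacy_set t" 1]
  by (simp add: conjugacy_def conjugacy_set_add_1 conjugacy_set_nonempty conjugacy_set_bdd)

lemma conjugacy_add_int: "conjugacy (t + of_int k) = conjugacy t + of_int k"
  using periodic_add_int[of "\<lambda>t. conjugacy t - t" t k] conjugacy_add_1 by simp

lemma conjugacy_funpow_F: "conjugacy ((F ^^ n) t) = conjugacy t + real n * rot"
  by (induction n) (simp_all add: conjugacy_F algebra_simps)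

lemma mono_conjugacy: "mono conjugacy"
proof (rule monoI)
  fix s t :: real assume "s \<le> t"
  then have "(F ^^ n) s \<le> (F ^^ n) t" "(inv F ^^ n) s \<le> (inv F ^^ n) t" for n
    using strict_mono_less_eq[OF strict_mono_funpow_F[of n]]
    by (auto intro!: funpow_mono monoI inv_F_mono)
  then have "\<exists>y\<in>conjugacy_set t. x \<le> y" if "x \<in> conjugacy_set s" for x
    using that unfolding conjugacy_set_def by (elim UnE rangeE) (auto intro: add_mono diff_mono)
  then show "conjugacy s \<le> conjugacy t"
    unfolding conjugacy_def by (intro cSup_mono conjugacy_set_nonempty conjugacy_set_bdd)
qed

text \<open>The functional equations put all numbers \<open>conjugacy 0 + k * rot + m\<close> into
  the range, and these are dense for irrational \<open>rot\<close>.\<close>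

lemma continuous_conjugacy:
  assumes "rot \<notin> \<rat>"
  shows "continuous_on UNIV conjugacy"
proof (rule mono_dense_range_continuous[OF mono_conjugacy])
  fix u v :: real assume "u < v"
  then have "(v - u) / 2 > 0"
    by simp
  then obtain k :: nat and m :: int
    where "\<bar>conjugacy 0 + real k * rot + of_int m - (u + v) / 2\<bar> < (v - u) / 2"
    using irrational_orbit_dense[OF assms] by blast
  then have "u < conjugacy 0 + real k * rot + of_int m" "conjugacy 0 + real k * rot + of_int m < v"
    by (simp_all only: abs_less_iff, simp_all add: field_simps)
  then have "u < conjugacy ((F ^^ k) 0 + of_int m) \<and> conjugacy ((F ^^ k) 0 + of_int m) < v"
    unfolding conjugacy_add_int conjugacy_funpow_F by blast
  then show "\<exists>t. u < conjugacy t \<and> conjugacy t < v"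
    by blast
qed

section \<open>Points of growth and strict monotonicity\<close>

text \<open>For the monotone function \<open>conjugacy\<close> this is the support of its Stieltjes
  measure. The quantification over \<open>a\<close> and \<open>b\<close> makes the complement a
  union of open intervals.\<close>

definition growth_set :: "real set" where
  "growth_set = {t. \<forall>a b. a < t \<longrightarrow> t < b \<longrightarrow> conjugacy a < conjugacy b}"

lemma closed_growth_set: "closed growth_set"
proof -
  have "- growth_set = (\<Union>(a, b)\<in>{(a, b). \<not> conjugacy a < conjugacy b}. {a<..<b})"
    by (auto simp: growth_set_def)
  moreover have "open \<dots>"
    by auto
  ultimately show ?thesis
    by (simp add: closed_def)
qed

lemma growth_set_add_int: "t \<in> growth_set \<Longrightarrow> t + of_int k \<in> growth_set"
  unfolding growth_set_def
proof safe
  fix a b assume t: "\<forall>a b. a < t \<longrightarrow> t < b \<longrightarrow> conjugacy a < conjugacy b" "a < t + of_int k" "t + of_int k < b"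
  then have "conjugacy (a + of_int (- k)) < conjugacy (b + of_int (- k))"
    by simp
  then show "conjugacy a < conjugacy b"
    unfolding conjugacy_add_int by simp
qed

text \<open>\<open>F\<close> is an order automorphism of the line, so all neighbours of
  \<open>F t\<close> have the form \<open>F a\<close>, and composing with \<open>F\<close> only adds
  the constant \<open>rot\<close> to \<open>conjugacy\<close>.\<close>

lemma growth_set_F: "F t \<in> growth_set \<longleftrightarrow> t \<in> growth_set"
proof -
  have "F t \<in> growth_set \<longleftrightarrow> (\<forall>a b. F a < F t \<longrightarrow> F t < F b \<longrightarrow> conjugacy (F a) < conjugacy (F b))"
  proof
    assume F: "\<forall>a b. F a < F t \<longrightarrow> F t < F b \<longrightarrow> conjugacy (F a) < conjugacy (F b)"
    have "conjugacy a < conjugacy b" if "a < F t" "F t < b" for a b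
      using F[rule_format, of "inv F a" "inv F b"] that unfolding F_inv by blast
    then show "F t \<in> growth_set"
      by (simp add: growth_set_def)
  qed (simp add: growth_set_def)
  then show ?thesis
    by (simp add: conjugacy_F growth_set_def)
qed

text \<open>The last point at which \<open>conjugacy\<close> passes from values at most 0 to
  positive values is a point of growth.\<close>

lemma growth_set_nonempty: "growth_set \<noteq> {}"
proof -
  let ?S = "{t. conjugacy t \<le> 0}"
  \<comment> \<open>Suitable integer translates of 0 give values on both sides, so the set
    \<open>?S\<close> is nonempty and bounded above.\<close>
  have "conjugacy (0 + of_int (- \<lceil>conjugacy 0\<rceil>)) \<le> 0" "conjugacy (0 + of_int (1 - \<lfloor>conjugacy 0\<rfloor>)) > 0"
    unfolding conjugacy_add_int by (simp_all, linarith+)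
  then obtain u v where uv: "conjugacy u \<le> 0" "conjugacy v > 0"
    by blast
  have "t \<le> v" if "t \<in> ?S" for t
    using that uv monoD[OF mono_conjugacy, of v t] by (cases "t \<le> v") auto
  then have bdd: "bdd_above ?S"
    by (rule bdd_aboveI)
  have "conjugacy a < conjugacy b" if ab: "a < Sup ?S" "Sup ?S < b" for a b
  proof -
    obtain t where "conjugacy t \<le> 0" "a < t"
      using ab(1) uv(1) less_cSup_iff[OF _ bdd, of a] by auto
    then have "conjugacy a \<le> 0"
      using monoD[OF mono_conjugacy, of a t] by simp
    moreover have "conjugacy b > 0"
      using cSup_upper[OF _ bdd, of b] ab(2) by (auto simp: not_le[symmetric])
    ultimately show ?thesis
      by simp
  qed
  then show ?thesis
    unfolding growth_set_def by blast
qed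

text \<open>The projection of \<open>growth_set\<close> to the circle is closed, nonempty and mapped
  onto itself by \<open>f\<close>, hence is everything; invariance under integer translations
  carries this back to the line.\<close>

lemma minimal_growth_set:
  assumes "minimal_circle_homeo f" "\<And>t. circ (F t) = f (circ t)"
  shows "growth_set = UNIV"
proof -
  \<comment> \<open>The part in the compact unit interval already has the full projection, which is
    therefore compact.\<close>
  have img: "circ ` growth_set = circ ` (growth_set \<inter> {0..1})"
  proof
    show "circ ` growth_set \<subseteq> circ ` (growth_set \<inter> {0..1})"
    proof
      fix z assume "z \<in> circ ` growth_set"
      then obtain t where t: "z = circ t" "t \<in> growth_set"
        by auto
      then have "t + of_int (- \<lfloor>t\<rfloor>) \<in> growth_set \<inter> {0..1}"
        using growth_set_add_int[of t "- \<lfloor>t\<rfloor>"] by simp linarith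
      moreover have "z = circ (t + of_int (- \<lfloor>t\<rfloor>))"
        using t circ_add_Ints by (metis Ints_of_int)
      ultimately show "z \<in> circ ` (growth_set \<inter> {0..1})"
        by (rule rev_image_eqI)
    qed
  qed auto
  have "compact (circ ` (growth_set \<inter> {0..1}))"
    by (intro compact_continuous_image continuous_on_circ closed_Int_compact closed_growth_set) auto
  then have "closed (circ ` growth_set)"
    by (simp add: img compact_imp_closed)
  moreover have "F ` growth_set = growth_set"
  proof
    show "growth_set \<subseteq> F ` growth_set"
    proof
      fix t assume "t \<in> growth_set"
      then have "inv F t \<in> growth_set"
        using growth_set_F[of "inv F t"] by simp
      then show "t \<in> F ` growth_set"
        by (rule rev_image_eqI) simp
    qed
  qed (use growth_set_F in auto)
  then have "f ` circ ` growth_set = circ ` growth_set"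
    using image_image[of circ F growth_set] image_image[of f circ growth_set] by (simp add: assms(2))
  ultimately have circle: "circ ` growth_set = circle"
    using growth_set_nonempty
    by (intro minimal_circle_homeo_fixed_set[OF assms(1)]) auto
  have "t \<in> growth_set" for t
  proof -
    obtain s where "s \<in> growth_set" "circ t = circ s"
      using circle circ_in_circle[of t] by (metis imageE)
    moreover then obtain k :: int where "t - s = of_int k"
      by (auto simp: circ_eq_iff elim: Ints_cases)
    then have "t = s + of_int k"
      by simp
    ultimately show ?thesis
      using growth_set_add_int by simp
  qed
  then show ?thesis
    by blast
qed

text \<open>The midpoint of \<open>a\<close> and \<open>b\<close> is a point of growth with
  \<open>a\<close> and \<open>b\<close> on either side.\<close>

lemma minimal_strict_mono_conjugacy:
  assumes "minimal_circle_homeo f" "\<And>t. circ (F t) = f (circ t)"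
  shows "strict_mono conjugacy"
proof (rule strict_monoI)
  fix a b :: real assume "a < b"
  moreover have "(a + b) / 2 \<in> growth_set"
    using minimal_growth_set[OF assms] by simp
  ultimately show "conjugacy a < conjugacy b"
    unfolding growth_set_def by (auto dest!: spec[of _ a] spec[of _ b])
qed

lemma funpow_semiconj:
  assumes "\<And>t. circ (F t) = f (circ t)"
  shows "(f ^^ n) (circ t) = circ ((F ^^ n) t)"
  by (induction n) (simp_all add: assms)

lemma minimal_rot_irrational:
  assumes "minimal_circle_homeo f" "\<And>t. circ (F t) = f (circ t)"
  shows "rot \<notin> \<rat>"
proof
  assume "rot \<in> \<rat>"
  then obtain q p t where "q > 0" "(F ^^ q) t = t + of_int p"
    using rational_rot_periodic by blast
  then have "(f ^^ q) (circ t) = circ t"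
    by (simp add: funpow_semiconj[OF assms(2)] circ_add_Ints)
  then show False
    using minimal_circle_homeo_not_periodic[OF assms(1) circ_in_circle \<open>q > 0\<close>] by blast
qed

end

text \<open>The parametrization is \<open>circ\<close> after the inverse of
  \<open>conjugacy\<close>. It turns functions on the circle into periodic functions on the line and
  \<open>f\<close> into a translation.\<close>

lemma minimal_circle_homeo_parametrization:
  assumes "minimal_circle_homeo f"
  obtains k :: "real \<Rightarrow> complex" and \<rho> where
    "continuous_on UNIV k" "\<And>t. k (t + 1) = k t" "range k = circle"
    "\<rho> \<notin> \<rat>" "\<And>n t. (f ^^ n) (k t) = k (t + real n * \<rho>)"
proof -
  obtain F where F: "strict_mono F" "continuous_on UNIV F" "\<And>t. F (t + 1) = F t + 1"
    "\<And>t. circ (F t) = f (circ t)"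
    using minimal_circle_homeo_lift[OF assms] by blast
  interpret degree_one_lift F
    using F by unfold_locales
  have irr: "rot \<notin> \<rat>"
    using minimal_rot_irrational[OF assms F(4)] .
  \<comment> \<open>\<open>conjugacy\<close> is itself an increasing map commuting with the unit
    translation, so the facts about the inverse of a lift apply to it.\<close>
  interpret C: degree_one_lift conjugacy
    using minimal_strict_mono_conjugacy[OF assms F(4)] continuous_conjugacy[OF irr] conjugacy_add_1
    by unfold_locales
  have conjugacy_eq: "s = inv conjugacy t" if "conjugacy s = t" for s t
    using that by auto
  have "continuous_on UNIV (inv conjugacy)"
  proof (rule mono_dense_range_continuous)
    show "mono (inv conjugacy)"
      by (rule monoI) (rule C.inv_F_mono)
    fix u v :: real assume "u < v"
    then show "\<exists>t. u < inv conjugacy t \<and> inv conjugacy t < v"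
      by (intro exI[of _ "conjugacy ((u + v) / 2)"]) simp
  qed
  show ?thesis
  proof
    show "continuous_on UNIV (\<lambda>t. circ (inv conjugacy t))"
      using \<open>continuous_on UNIV (inv conjugacy)\<close>
      by (intro continuous_on_compose2[OF continuous_on_circ[of UNIV]]) auto
    show "circ (inv conjugacy (t + 1)) = circ (inv conjugacy t)" for t
      by (simp add: C.inv_F_add_1 circ_add_Ints)
    show "range (\<lambda>t. circ (inv conjugacy t)) = circle"
    proof
      show "circle \<subseteq> range (\<lambda>t. circ (inv conjugacy t))"
      proof
        fix z assume "z \<in> circle"
        then obtain t where "z = circ t"
          by (rule circleE)
        then show "z \<in> range (\<lambda>t. circ (inv conjugacy t))"
          by (intro range_eqI[of _ _ "conjugacy t"]) simp
      qed
    qed auto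
    show "rot \<notin> \<rat>"
      by (rule irr)
    show "(f ^^ n) (circ (inv conjugacy t)) = circ (inv conjugacy (t + real n * rot))" for n t
      by (simp add: funpow_semiconj[OF F(4)] conjugacy_eq[of "(F ^^ n) (inv conjugacy t)"] conjugacy_funpow_F)
  qed
qed

section \<open>Equidistribution\<close>

lemma emeasure_lborel_translate:
  fixes c :: real
  assumes "X \<in> sets borel"
  shows "emeasure lborel ((\<lambda>t. t + c) -` X) = emeasure lborel X"
proof -
  have "emeasure lborel X = emeasure (distr lborel borel ((+) c)) X"
    by (simp add: lborel_distr_plus)
  also have "\<dots> = emeasure lborel ((+) c -` X)"
    using assms by (simp add: emeasure_distr)
  also have "(+) c = (\<lambda>t. t + c)"
    by (simp add: fun_eq_iff add.commute)
  finally show ?thesis ..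
qed

text \<open>Only the fractional part \<open>r\<close> of \<open>c\<close> matters. Translation turns
  the unit interval into the window from \<open>r\<close> to \<open>1 + r\<close>, and by
  periodicity the piece beyond 1 moves back to fill the gap below \<open>r\<close>.\<close>

lemma emeasure_periodic_translate:
  fixes B :: "real set"
  assumes B [measurable]: "B \<in> sets borel" and per: "\<And>t. t + 1 \<in> B \<longleftrightarrow> t \<in> B"
  shows "emeasure lborel ({0..<1} \<inter> (\<lambda>t. t + c) -` B) = emeasure lborel ({0..<1} \<inter> B)"
proof -
  define r where "r = frac c"
  have r: "0 \<le> r" "r < 1"
    by (auto simp: r_def frac_lt_1)
  have "t + c \<in> B \<longleftrightarrow> t + r \<in> B" for t
    using periodic_add_int[of "\<lambda>t. t \<in> B" "t + r" "\<lfloor>c\<rfloor>"] per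
    by (simp add: r_def frac_def algebra_simps)
  then have "{0..<1} \<inter> (\<lambda>t. t + c) -` B = (\<lambda>t. t + r) -` ({r..<1 + r} \<inter> B)"
    by auto
  also have "emeasure lborel \<dots> = emeasure lborel ({r..<1 + r} \<inter> B)"
    by (rule emeasure_lborel_translate) measurable
  also have "{r..<1 + r} \<inter> B = ({r..<1} \<inter> B) \<union> ({1..<1 + r} \<inter> B)"
    using r by auto
  also have "emeasure lborel \<dots> = emeasure lborel ({r..<1} \<inter> B) + emeasure lborel ({1..<1 + r} \<inter> B)"
    by (rule plus_emeasure[symmetric]) auto
  also have "emeasure lborel ({1..<1 + r} \<inter> B) = emeasure lborel ((\<lambda>t. t + 1) -` ({1..<1 + r} \<inter> B))"
    by (rule emeasure_lborel_translate[symmetric]) measurable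
  also have "(\<lambda>t. t + 1) -` ({1..<1 + r} \<inter> B) = {0..<r} \<inter> B"
    using per by auto
  also have "emeasure lborel ({r..<1} \<inter> B) + emeasure lborel ({0..<r} \<inter> B)
      = emeasure lborel (({r..<1} \<inter> B) \<union> ({0..<r} \<inter> B))"
    by (rule plus_emeasure) auto
  also have "({r..<1} \<inter> B) \<union> ({0..<r} \<inter> B) = {0..<1} \<inter> B"
    using r by auto
  finally show ?thesis .
qed

abbreviation unit_uniform :: "real measure" where
  "unit_uniform \<equiv> uniform_measure lborel {0..<1}"

lemma prob_space_unit_uniform: "prob_space unit_uniform"
  by (rule prob_space_uniform_measure) auto

text \<open>Stated for a general target so that it serves both for real observables, where it gives
  the mean of translates, and for the circle, where it gives invariance of the measure.\<close>

lemma distr_unit_uniform_translate: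
  assumes [measurable]: "k \<in> borel \<rightarrow>\<^sub>M M" and per: "\<And>t. k (t + 1) = k t"
  shows "distr unit_uniform M (\<lambda>t. k (t + c)) = distr unit_uniform M k"
proof (rule measure_eqI)
  fix A assume "A \<in> sets (distr unit_uniform M (\<lambda>t. k (t + c)))"
  then have A [measurable]: "A \<in> sets M"
    by simp
  have [measurable]: "k -` A \<in> sets borel"
    using measurable_sets[OF assms(1) A] by simp
  have "(\<lambda>t. k (t + c)) -` A = (\<lambda>t. t + c) -` (k -` A)"
    by auto
  moreover have "(\<lambda>t. t + c) -` (k -` A) \<in> sets borel"
    by (intro measurable_sets_borel[of _ borel]) measurable
  ultimately show "emeasure (distr unit_uniform M (\<lambda>t. k (t + c))) A = emeasure (distr unit_uniform M k) A"
    using emeasure_periodic_translate[of "k -` A" c] per by (simp add: emeasure_distr)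
qed simp

section \<open>Averages of periodic functions along irrational rotations\<close>

lemma continuous_periodic_bounded:
  fixes \<psi> :: "real \<Rightarrow> real"
  assumes "continuous_on UNIV \<psi>" "\<And>t. \<psi> (t + 1) = \<psi> t"
  obtains B where "\<And>t. \<bar>\<psi> t\<bar> \<le> B"
proof -
  have "compact (\<psi> ` {0..1})"
    by (intro compact_continuous_image continuous_on_subset[OF assms(1)]) auto
  then obtain B where B: "\<And>t. t \<in> {0..1} \<Longrightarrow> \<bar>\<psi> t\<bar> \<le> B"
    using compact_imp_bounded by (force simp: bounded_iff)
  have "\<bar>\<psi> t\<bar> \<le> B" for t
    using B[of "frac t"] periodic_add_int[of \<psi> "frac t" "\<lfloor>t\<rfloor>"] assms(2) frac_lt_1[of t]
    by (simp add: frac_def)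
  then show ?thesis
    using that by blast
qed

lemma continuous_periodic_uniformly:
  fixes \<psi> :: "real \<Rightarrow> real"
  assumes "continuous_on UNIV \<psi>" "\<And>t. \<psi> (t + 1) = \<psi> t" "\<epsilon> > 0"
  obtains \<delta> where "\<delta> > 0" "\<And>s t. \<bar>s - t\<bar> < \<delta> \<Longrightarrow> \<bar>\<psi> s - \<psi> t\<bar> < \<epsilon>"
proof -
  have "uniformly_continuous_on {-1..2} \<psi>"
    by (intro compact_uniformly_continuous continuous_on_subset[OF assms(1)]) auto
  then obtain \<delta> where \<delta>: "\<delta> > 0"
    "\<And>s t. s \<in> {-1..2} \<Longrightarrow> t \<in> {-1..2} \<Longrightarrow> \<bar>s - t\<bar> < \<delta> \<Longrightarrow> \<bar>\<psi> s - \<psi> t\<bar> < \<epsilon>"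
    using assms(3) unfolding uniformly_continuous_on_def dist_real_def by metis
  \<comment> \<open>Translating \<open>t\<close> into the unit interval keeps \<open>s\<close>,
    which is closer than 1, inside the compact interval from -1 to 2.\<close>
  have "\<bar>\<psi> s - \<psi> t\<bar> < \<epsilon>" if "\<bar>s - t\<bar> < min \<delta> 1" for s t
  proof -
    have "0 \<le> t - of_int \<lfloor>t\<rfloor>" "t - of_int \<lfloor>t\<rfloor> < 1"
      by linarith+
    then have "\<bar>\<psi> (s - of_int \<lfloor>t\<rfloor>) - \<psi> (t - of_int \<lfloor>t\<rfloor>)\<bar> < \<epsilon>"
      using that by (intro \<delta>(2)) (simp_all, linarith+)
    then show ?thesis
      using periodic_add_int[of \<psi> _ "- \<lfloor>t\<rfloor>"] assms(2) by simp
  qed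
  then show ?thesis
    using that[of "min \<delta> 1"] \<delta>(1) by auto
qed

text \<open>Each unit shift of the window exchanges one term for another, at a cost of at most
  \<open>2 * B\<close>.\<close>

lemma sum_shift_bound:
  fixes a :: "nat \<Rightarrow> real"
  assumes "\<And>i. \<bar>a i\<bar> \<le> B"
  shows "\<bar>(\<Sum>i<n. a (k + i)) - (\<Sum>i<n. a i)\<bar> \<le> 2 * real k * B"
proof (induction k)
  case (Suc k)
  have "(\<Sum>i<n. a (Suc k + i)) - (\<Sum>i<n. a (k + i)) = a (k + n) - a k"
    using sum_lessThan_telescope[of "\<lambda>i. a (k + i)" n] by (simp add: sum_subtractf)
  then show ?case
    using Suc assms[of "k + n"] assms[of k] by (simp add: algebra_simps abs_le_iff)
qed simp

text \<open>After a delay of \<open>k\<close> steps the orbit of \<open>y\<close> comes close to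
  \<open>t\<close> modulo 1, and translations keep the two orbits equally close from then on. The
  delay changes the sum by a bounded amount, which division by \<open>n\<close> makes
  negligible.\<close>

lemma rotation_averages_asymptotic:
  fixes \<psi> :: "real \<Rightarrow> real"
  assumes "continuous_on UNIV \<psi>" "\<And>t. \<psi> (t + 1) = \<psi> t" "\<rho> \<notin> \<rat>"
  shows "(\<lambda>n. (\<Sum>i<n. \<psi> (t + real i * \<rho>)) / real n - (\<Sum>i<n. \<psi> (y + real i * \<rho>)) / real n) \<longlonglongrightarrow> 0"
proof (rule LIMSEQ_I)
  fix \<epsilon> :: real assume "\<epsilon> > 0"
  obtain B where B: "\<And>t. \<bar>\<psi> t\<bar> \<le> B"
    using continuous_periodic_bounded[OF assms(1,2)] by blast
  obtain \<delta> where \<delta>: "\<delta> > 0" "\<And>s t. \<bar>s - t\<bar> < \<delta> \<Longrightarrow> \<bar>\<psi> s - \<psi> t\<bar> < \<epsilon> / 2"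
    using continuous_periodic_uniformly[OF assms(1,2), of "\<epsilon> / 2"] \<open>\<epsilon> > 0\<close> by auto
  obtain k m where km: "\<bar>y + real k * \<rho> + of_int m - t\<bar> < \<delta>"
    using irrational_orbit_dense[OF assms(3) \<delta>(1)] by blast
  \<comment> \<open>Beyond \<open>N\<close> the cost \<open>2 * k * B\<close> of the delay stays
    below half of the allowed error; \<open>Suc N\<close> also keeps \<open>n\<close>
    positive.\<close>
  obtain N :: nat where N: "4 * real k * B / \<epsilon> < real N"
    using reals_Archimedean2 by blast
  have "\<bar>(\<Sum>i<n. \<psi> (t + real i * \<rho>)) / real n - (\<Sum>i<n. \<psi> (y + real i * \<rho>)) / real n\<bar> < \<epsilon>"
    if "n \<ge> Suc N" for n
  proof -
    have "\<bar>\<psi> (t + real i * \<rho>) - \<psi> (y + real (k + i) * \<rho>)\<bar> \<le> \<epsilon> / 2" for i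
      using \<delta>(2)[of "t + real i * \<rho>" "y + real (k + i) * \<rho> + of_int m"] km
        periodic_add_int[of \<psi> "y + real (k + i) * \<rho>" m] assms(2)
      by (simp add: algebra_simps abs_minus_commute)
    then have "\<bar>\<Sum>i<n. \<psi> (t + real i * \<rho>) - \<psi> (y + real (k + i) * \<rho>)\<bar> \<le> real n * (\<epsilon> / 2)"
      using sum_norm_le[of "{..<n}" "\<lambda>i. \<psi> (t + real i * \<rho>) - \<psi> (y + real (k + i) * \<rho>)" "\<lambda>_. \<epsilon> / 2"]
      by simp
    moreover have "\<bar>(\<Sum>i<n. \<psi> (y + real (k + i) * \<rho>)) - (\<Sum>i<n. \<psi> (y + real i * \<rho>))\<bar> \<le> 2 * real k * B"
      using B by (rule sum_shift_bound)
    moreover have "2 * real k * B < real n * (\<epsilon> / 2)"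
    proof -
      have "4 * real k * B / \<epsilon> < real n"
        using N that by simp
      then show ?thesis
        using \<open>\<epsilon> > 0\<close> by (simp add: field_simps)
    qed
    ultimately have "\<bar>(\<Sum>i<n. \<psi> (t + real i * \<rho>)) - (\<Sum>i<n. \<psi> (y + real i * \<rho>))\<bar> < real n * \<epsilon>"
      unfolding sum_subtractf by linarith
    then show ?thesis
      using that by (simp add: diff_divide_distrib[symmetric] abs_div field_simps)
  qed
  then show "\<exists>no. \<forall>n\<ge>no. norm ((\<Sum>i<n. \<psi> (t + real i * \<rho>)) / real n
      - (\<Sum>i<n. \<psi> (y + real i * \<rho>)) / real n - 0) < \<epsilon>"
    by auto
qed

lemma abs_average_le:
  fixes a :: "nat \<Rightarrow> real"
  assumes "\<And>i. \<bar>a i\<bar> \<le> B"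
  shows "\<bar>(\<Sum>i<n. a i) / real n\<bar> \<le> B"
proof (cases "n = 0")
  \<comment> \<open>The quotient by 0 is 0, and \<open>B\<close> is nonnegative because it bounds an
    absolute value.\<close>
  case True
  then show ?thesis
    using assms[of 0] by simp
next
  case False
  have "\<bar>\<Sum>i<n. a i\<bar> \<le> real n * B"
    using sum_norm_le[of "{..<n}" a "\<lambda>_. B"] assms by simp
  then show ?thesis
    using False by (simp add: field_simps)
qed

text \<open>Averages over different starting points are asymptotic, so each one is asymptotic to the
  mean of all of them, which is the integral because rotations preserve the uniform measure.\<close>

lemma irrational_rotation_equidistributed:
  fixes \<psi> :: "real \<Rightarrow> real"
  assumes "continuous_on UNIV \<psi>" "\<And>t. \<psi> (t + 1) = \<psi> t" "\<rho> \<notin> \<rat>"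
  shows "(\<lambda>n. (\<Sum>i<n. \<psi> (y + real i * \<rho>)) / real n) \<longlonglongrightarrow> integral\<^sup>L unit_uniform \<psi>"
proof -
  interpret U: prob_space unit_uniform
    by (rule prob_space_unit_uniform)
  obtain B where B: "\<And>t. \<bar>\<psi> t\<bar> \<le> B"
    using continuous_periodic_bounded[OF assms(1,2)] by blast
  have [measurable]: "\<psi> \<in> borel_measurable borel"
    using assms(1) by (rule borel_measurable_continuous_onI)
  define A where "A n t = (\<Sum>i<n. \<psi> (t + real i * \<rho>)) / real n" for n t
  have [measurable]: "A n \<in> borel_measurable borel" for n
    unfolding A_def by measurable
  have A_bound: "\<bar>A n t\<bar> \<le> B" for n t
    unfolding A_def using B by (rule abs_average_le)
  have int_A: "integrable unit_uniform (A n)" for n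
    by (rule U.integrable_const_bound[where B = B]) (auto simp: A_bound)
  have int_\<psi>: "integrable unit_uniform (\<lambda>t. \<psi> (t + c))" for c
    by (rule U.integrable_const_bound[where B = B]) (auto simp: B)
  have shift: "(\<integral>t. \<psi> (t + c) \<partial>unit_uniform) = integral\<^sup>L unit_uniform \<psi>" for c
  proof -
    have "(\<integral>t. \<psi> (t + c) \<partial>unit_uniform) = (\<integral>x. x \<partial>distr unit_uniform borel (\<lambda>t. \<psi> (t + c)))"
      by (subst integral_distr) auto
    also have "distr unit_uniform borel (\<lambda>t. \<psi> (t + c)) = distr unit_uniform borel \<psi>"
      using assms(2) by (intro distr_unit_uniform_translate) auto
    also have "(\<integral>x. x \<partial>distr unit_uniform borel \<psi>) = integral\<^sup>L unit_uniform \<psi>"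
      by (subst integral_distr) auto
    finally show ?thesis .
  qed
  have mean: "integral\<^sup>L unit_uniform (A n) = integral\<^sup>L unit_uniform \<psi>" if "n > 0" for n
    unfolding A_def using that by (simp add: int_\<psi> shift)
  \<comment> \<open>Integrating over the starting point \<open>t\<close> with \<open>y\<close> fixed
    replaces \<open>A n t\<close> by its mean, which is the constant integral of \<psi> once
    \<open>n\<close> is positive.\<close>
  have "(\<lambda>n. \<integral>t. A n t - A n y \<partial>unit_uniform) \<longlonglongrightarrow> (\<integral>t. 0 \<partial>unit_uniform)"
  proof (rule integral_dominated_convergence[where w = "\<lambda>_. 2 * B"])
    show "AE t in unit_uniform. (\<lambda>n. A n t - A n y) \<longlonglongrightarrow> 0"
      unfolding A_def using rotation_averages_asymptotic[OF assms] by simp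
    have "\<bar>A n t - A n y\<bar> \<le> 2 * B" for n t
      using A_bound[of n t] A_bound[of n y] by linarith
    then show "AE t in unit_uniform. norm (A n t - A n y) \<le> 2 * B" for n
      by simp
  qed auto
  then have "(\<lambda>n. integral\<^sup>L unit_uniform (A n) - A n y) \<longlonglongrightarrow> 0"
    using int_A U.prob_space by simp
  then have "(\<lambda>n. integral\<^sup>L unit_uniform \<psi> - (integral\<^sup>L unit_uniform (A n) - A n y))
      \<longlonglongrightarrow> integral\<^sup>L unit_uniform \<psi> - 0"
    by (intro tendsto_intros)
  moreover have "\<forall>\<^sub>F n in sequentially. integral\<^sup>L unit_uniform \<psi>
      - (integral\<^sup>L unit_uniform (A n) - A n y) = A n y"
    using eventually_gt_at_top[of 0] by eventually_elim (simp add: mean)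
  ultimately have "(\<lambda>n. A n y) \<longlonglongrightarrow> integral\<^sup>L unit_uniform \<psi> - 0"
    by (rule Lim_transform_eventually)
  then show ?thesis
    by (simp add: A_def)
qed

section \<open>The natural measure\<close>

text \<open>The average is the mixture of the measures under a uniformly random index below
  \<open>n\<close>, so the integration formula for the monadic bind applies; positivity of
  \<open>n\<close> makes the index set nonempty.\<close>

lemma integral_average_measure:
  fixes \<phi> :: "complex \<Rightarrow> real"
  assumes \<mu>s: "\<And>i. borel_prob (\<mu>s i)"
    and \<phi>: "\<phi> \<in> borel_measurable circle_borel" "\<And>z. z \<in> circle \<Longrightarrow> \<bar>\<phi> z\<bar> \<le> B" and "n > 0"
  shows "integral\<^sup>L (average_measure \<mu>s n) \<phi> = (\<Sum>i<n. integral\<^sup>L (\<mu>s i) \<phi>) / real n"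
proof -
  let ?P = "measure_pmf (pmf_of_set {..<n})"
  have n: "{..<n} \<noteq> {}" "finite {..<n}"
    using \<open>n > 0\<close> by auto
  have sets: "sets (\<mu>s i) = sets circle_borel" for i
    using \<mu>s by (simp add: borel_prob_def)
  have prob: "prob_space (\<mu>s i)" for i
    using \<mu>s by (simp add: borel_prob_def)
  have kernel: "\<mu>s \<in> ?P \<rightarrow>\<^sub>M subprob_algebra circle_borel"
    using prob sets by (auto simp: space_subprob_algebra intro: prob_space_imp_subprob_space)
  have "average_measure \<mu>s n = ?P \<bind> \<mu>s"
  proof (rule measure_eqI)
    have "sets (average_measure \<mu>s n) = sets circle_borel"
      using sets.sets_measure_of_eq[of circle_borel]
      by (simp add: average_measure_def space_restrict_space)
    moreover have "sets (?P \<bind> \<mu>s) = sets circle_borel"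
      by (rule sets_bind) (simp_all add: sets)
    ultimately show "sets (average_measure \<mu>s n) = sets (?P \<bind> \<mu>s)"
      by simp
    fix A assume "A \<in> sets (average_measure \<mu>s n)"
    with \<open>sets (average_measure \<mu>s n) = sets circle_borel\<close> have A: "A \<in> sets circle_borel"
      by simp
    have "emeasure (?P \<bind> \<mu>s) A = (\<Sum>i<n. emeasure (\<mu>s i) A) / ennreal (real n)"
      using n by (simp add: emeasure_bind[OF _ kernel A] nn_integral_pmf_of_set ennreal_of_nat_eq_real_of_nat)
    also have "\<dots> = ennreal (1 / real n) * (\<Sum>i<n. emeasure (\<mu>s i) A)"
      using \<open>n > 0\<close> by (simp add: divide_ennreal_def inverse_ennreal mult.commute inverse_eq_divide)
    finally show "emeasure (average_measure \<mu>s n) A = emeasure (?P \<bind> \<mu>s) A"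
      by (simp add: emeasure_average_measure[of \<mu>s, OF sets A])
  qed
  moreover have "integral\<^sup>L (?P \<bind> \<mu>s) \<phi> = (\<integral>i. integral\<^sup>L (\<mu>s i) \<phi> \<partial>?P)"
  proof (rule integral_bind[where K = circle_borel and B = B and B' = 1])
    show "AE i in ?P. emeasure (\<mu>s i) (space (\<mu>s i)) \<le> ennreal 1"
      using prob by (simp add: prob_space.emeasure_space_1)
  qed (use \<phi> kernel in \<open>auto simp: space_restrict_space measure_pmf.finite_measure_axioms\<close>)
  ultimately show ?thesis
    using n by (simp add: integral_pmf_of_set)
qed

lemma continuous_on_circle_bounded:
  fixes \<phi> :: "complex \<Rightarrow> real"
  assumes "continuous_on circle \<phi>"
  obtains B where "\<And>z. z \<in> circle \<Longrightarrow> \<bar>\<phi> z\<bar> \<le> B"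
proof -
  have "compact (\<phi> ` circle)"
    by (intro compact_continuous_image assms) simp
  then obtain B where "\<forall>x\<in>\<phi> ` circle. norm x \<le> B"
    using compact_imp_bounded bounded_iff by metis
  then show ?thesis
    by (intro that[of B]) auto
qed

theorem theorem3:
  fixes f :: "complex \<Rightarrow> complex"
  assumes "minimal_circle_homeo f"
  shows "\<exists>\<mu>. natural_measure_strong f \<mu> \<and> physical_measure f \<mu>"
proof -
  obtain k \<rho> where k: "continuous_on UNIV k" "\<And>t. k (t + 1) = k t" "range k = circle"
    and \<rho>: "\<rho> \<notin> \<rat>" and conj: "\<And>n t. (f ^^ n) (k t) = k (t + real n * \<rho>)"
    using minimal_circle_homeo_parametrization[OF assms] by blast
  have "k \<in> borel_measurable borel"
    using k(1) by (rule borel_measurable_continuous_onI)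
  then have k_meas [measurable]: "k \<in> borel \<rightarrow>\<^sub>M circle_borel"
    using k(3) by (intro measurable_restrict_space2) auto
  obtain g where "homeomorphism circle circle f g"
    using assms(1) by (auto simp: minimal_circle_homeo_def circle_homeo_def)
  then have f: "continuous_on circle f" "f ` circle = circle"
    by (auto simp: homeomorphism_def)
  have fn: "(f ^^ n) z \<in> circle" if "z \<in> circle" for n z
    using that f(2) by (induction n) auto
  have "f \<in> borel_measurable circle_borel"
    using f(1) by (rule borel_measurable_continuous_on_restrict)
  then have f_meas [measurable]: "f \<in> circle_borel \<rightarrow>\<^sub>M circle_borel"
    using f(2) by (intro measurable_restrict_space2) (auto simp: space_restrict_space)
  then have fn_meas [measurable]: "(f ^^ n) \<in> circle_borel \<rightarrow>\<^sub>M circle_borel" for n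
    by (rule measurable_compose_n)
  define \<mu> where "\<mu> = distr unit_uniform circle_borel k"
  have \<mu>: "borel_prob \<mu>"
    by (simp add: \<mu>_def borel_prob_def prob_space.prob_space_distr[OF prob_space_unit_uniform])
  have phi_meas: "\<phi> \<in> borel_measurable circle_borel" if "continuous_on circle \<phi>" for \<phi> :: "complex \<Rightarrow> real"
    using that by (rule borel_measurable_continuous_on_restrict)
  \<comment> \<open>In the parametrization the orbit of \<open>z\<close> is a translation orbit, so
    equidistribution gives convergence at every point.\<close>
  have birkhoff: "(\<lambda>n. (\<Sum>i<n. \<phi> ((f ^^ i) z)) / real n) \<longlonglongrightarrow> integral\<^sup>L \<mu> \<phi>"
    if \<phi>: "continuous_on circle \<phi>" and "z \<in> circle" for \<phi> :: "complex \<Rightarrow> real" and z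
  proof -
    obtain y where y: "z = k y"
      using \<open>z \<in> circle\<close> k(3) by blast
    have "continuous_on UNIV (\<lambda>t. \<phi> (k t))"
      using k(3) by (intro continuous_on_compose2[OF \<phi> k(1)]) auto
    then have "(\<lambda>n. (\<Sum>i<n. \<phi> (k (y + real i * \<rho>))) / real n) \<longlonglongrightarrow> (\<integral>t. \<phi> (k t) \<partial>unit_uniform)"
      using k(2) \<rho> by (intro irrational_rotation_equidistributed) auto
    also have "(\<integral>t. \<phi> (k t) \<partial>unit_uniform) = integral\<^sup>L \<mu> \<phi>"
      unfolding \<mu>_def using phi_meas[OF \<phi>] by (subst integral_distr) auto
    finally show ?thesis
      by (simp add: y conj)
  qed
  have "weak_star_tendsto (average_measure (\<lambda>i. distr \<nu> circle_borel (f ^^ i))) \<mu>"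
    if \<nu>: "borel_prob \<nu>" for \<nu>
    unfolding weak_star_tendsto_def
  proof (intro allI impI)
    fix \<phi> :: "complex \<Rightarrow> real" assume \<phi>: "continuous_on circle \<phi>"
    note [measurable] = phi_meas[OF \<phi>]
    obtain B where B: "\<And>z. z \<in> circle \<Longrightarrow> \<bar>\<phi> z\<bar> \<le> B"
      using continuous_on_circle_bounded[OF \<phi>] by blast
    interpret \<nu>: prob_space \<nu>
      using \<nu> by (simp add: borel_prob_def)
    have [measurable_cong]: "sets \<nu> = sets circle_borel"
      using \<nu> by (simp add: borel_prob_def)
    then have space: "space \<nu> = circle"
      using sets_eq_imp_space_eq[of \<nu> circle_borel] by (simp add: space_restrict_space)
    have bound: "AE z in \<nu>. \<bar>\<phi> ((f ^^ i) z)\<bar> \<le> B" for i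
      using B[OF fn] by (intro AE_I2) (simp add: space)
    have "borel_prob (distr \<nu> circle_borel (f ^^ i))" for i
      by (simp add: borel_prob_def \<nu>.prob_space_distr)
    then have "integral\<^sup>L (average_measure (\<lambda>i. distr \<nu> circle_borel (f ^^ i)) n) \<phi> =
        (\<Sum>i<n. integral\<^sup>L (distr \<nu> circle_borel (f ^^ i)) \<phi>) / real n" if "n > 0" for n
      using that B by (intro integral_average_measure) auto
    moreover have "integrable \<nu> (\<lambda>z. \<phi> ((f ^^ i) z))" for i
      by (rule \<nu>.integrable_const_bound[where B = B]) (use bound in auto)
    \<comment> \<open>Change of variables turns the averaged push-forwards into the \<nu>-integral
      of Birkhoff averages. These are bounded by \<open>B\<close> and converge to a constant, so
      dominated convergence finishes the argument.\<close>
    ultimately have avg: "integral\<^sup>L (average_measure (\<lambda>i. distr \<nu> circle_borel (f ^^ i)) n) \<phi> =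
        (\<integral>z. (\<Sum>i<n. \<phi> ((f ^^ i) z)) / real n \<partial>\<nu>)" if "n > 0" for n
      using that by (simp add: integral_distr)
    have "(\<lambda>n. \<integral>z. (\<Sum>i<n. \<phi> ((f ^^ i) z)) / real n \<partial>\<nu>) \<longlonglongrightarrow> (\<integral>z. integral\<^sup>L \<mu> \<phi> \<partial>\<nu>)"
    proof (rule integral_dominated_convergence[where w = "\<lambda>_. B"])
      show "AE z in \<nu>. (\<lambda>n. (\<Sum>i<n. \<phi> ((f ^^ i) z)) / real n) \<longlonglongrightarrow> integral\<^sup>L \<mu> \<phi>"
        using birkhoff[OF \<phi>] by (intro AE_I2) (simp add: space)
      show "AE z in \<nu>. norm ((\<Sum>i<n. \<phi> ((f ^^ i) z)) / real n) \<le> B" for n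
        using abs_average_le[OF B[OF fn]] by (intro AE_I2) (simp add: space)
    qed auto
    then have "(\<lambda>n. \<integral>z. (\<Sum>i<n. \<phi> ((f ^^ i) z)) / real n \<partial>\<nu>) \<longlonglongrightarrow> integral\<^sup>L \<mu> \<phi>"
      by (simp add: \<nu>.prob_space)
    then show "(\<lambda>n. integral\<^sup>L (average_measure (\<lambda>i. distr \<nu> circle_borel (f ^^ i)) n) \<phi>)
        \<longlonglongrightarrow> integral\<^sup>L \<mu> \<phi>"
      using eventually_gt_at_top[of 0]
      by (rule Lim_transform_eventually[OF _ eventually_mono]) (simp add: avg)
  qed
  then have "natural_measure_strong f \<mu>"
    using \<mu> by (simp add: natural_measure_strong_def)
  moreover have "basin f \<mu> = circle"
  proof -
    have "weak_star_tendsto (average_measure (\<lambda>i. return circle_borel ((f ^^ i) z))) \<mu>"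
      if z: "z \<in> circle" for z
      unfolding weak_star_tendsto_def
    proof (intro allI impI)
      fix \<phi> :: "complex \<Rightarrow> real" assume \<phi>: "continuous_on circle \<phi>"
      obtain B where B: "\<And>z. z \<in> circle \<Longrightarrow> \<bar>\<phi> z\<bar> \<le> B"
        using continuous_on_circle_bounded[OF \<phi>] by blast
      have space: "(f ^^ i) z \<in> space circle_borel" for i
        using fn[OF z] by (simp add: space_restrict_space)
      then have "borel_prob (return circle_borel ((f ^^ i) z))" for i
        by (simp add: borel_prob_def prob_space_return)
      \<comment> \<open>Averages of Dirac measures integrate to Birkhoff averages, so membership in
        the basin is the pointwise convergence already shown.\<close>
      then have avg: "integral\<^sup>L (average_measure (\<lambda>i. return circle_borel ((f ^^ i) z)) n) \<phi> =
          (\<Sum>i<n. \<phi> ((f ^^ i) z)) / real n" if "n > 0" for n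
        using integral_average_measure[OF _ phi_meas[OF \<phi>] B that]
        by (simp add: integral_return[OF space phi_meas[OF \<phi>]])
      show "(\<lambda>n. integral\<^sup>L (average_measure (\<lambda>i. return circle_borel ((f ^^ i) z)) n) \<phi>)
          \<longlonglongrightarrow> integral\<^sup>L \<mu> \<phi>"
        using birkhoff[OF \<phi> z] eventually_gt_at_top[of 0]
        by (rule Lim_transform_eventually[OF _ eventually_mono]) (simp add: avg)
    qed
    then show ?thesis
      by (auto simp: basin_def)
  qed
  moreover have "distr \<mu> circle_borel f = \<mu>"
  proof -
    \<comment> \<open>Applying \<open>f\<close> after \<open>k\<close> translates the parameter by
      \<rho>, which leaves the image of the uniform measure unchanged.\<close>
    have "distr \<mu> circle_borel f = distr unit_uniform circle_borel (\<lambda>t. k (t + \<rho>))"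
      unfolding \<mu>_def using conj[of 1] by (simp add: distr_distr comp_def)
    also have "\<dots> = \<mu>"
      unfolding \<mu>_def using k(2) by (intro distr_unit_uniform_translate) auto
    finally show ?thesis .
  qed
  moreover have "emeasure circle_lebesgue circle > 0"
  proof -
    have "space circle_lebesgue = circle"
      by (simp add: circle_lebesgue_def space_restrict_space)
    then have "emeasure circle_lebesgue circle = 1"
      using borel_prob_circle_lebesgue by (metis borel_prob_def prob_space.emeasure_space_1)
    then show ?thesis
      by simp
  qed
  ultimately show ?thesis
    using \<mu> by (auto simp: physical_measure_def)
qed

end
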